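(* Let $g:[6]\times[6]\to\{0,1\}$, with $[6]=\{1,\dots,6\}$, be the function with $g(i,j)=|A_{ij}|$, where $A$ is the rank-3 matrix $$A=\begin{pmatrix}1&1&0&0&0&1\\0&1&0&-1&-1&0\\-1&1&1&0&-1&0\\-1&0&1&1&0&0\\1&0&0&1&1&1\\0&1&1&1&0&1\end{pmatrix}.$$ The diagonal is a 1-fooling set of size 6 for $g$. For an integer $k\geq1$ let $f:X\times Y\to\{0,1\}$ be the AND of $k$ independent instances of $g$, so $X=Y=[6]^k$, $|X|=|Y|=6^k$ and $f(x,y)=\prod_{i=1}^k g(x_i,y_i)$. Then $\mathrm{fool}^1(f)=6^k$, the $k$-fold tensor product $A^{\otimes k}$ is a nondeterministic matrix for $f$ of rank $3^k$, and $$NQ(f)\;\leq\;\frac{\log_2 3}{\log_2 6}\,\log_2\mathrm{fool}^1(f)+1,\qquad \frac{\log_2 3}{\log_2 6}\approx 0.613 .$$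
   Context: Fooling sets. A 1-fooling set for $f:X\times Y\to\{0,1\}$ is a set $F\subseteq X\times Y$ such that (1) $f(x,y)=1$ for all $(x,y)\in F$, and (2) for any two distinct $(x,y),(x',y')\in F$, $f(x,y')=0$ or $f(x',y)=0$. $\mathrm{fool}^1(f)$ is the maximal size of a 1-fooling set for $f$. Quantum protocols without prior entanglement. Alice receives $x\in X$, Bob receives $y\in Y$. A $q$-qubit protocol starts in a fixed state that is independent of the inputs and unentangled between Alice and Bob; there is no shared entanglement or shared randomness. The parties exchange $q$ qubits in total, each applying between messages operations that depend on their own input to the registers they hold. A measurement of the last qubit on the channel gives the output bit. Nondeterministic complexity. $NQ(f)$ is the minimal $q$ for which some $q$-qubit protocol without prior entanglement satisfies, for all $(x,y)\in X\times Y$: the probability of output 1 is positive if and only if $f(x,y)=1$. Nondeterministic rank. A nondeterministic matrix for $f$ is any real or complex matrix $M$, with rows indexed by $X$ and columns by $Y$, such that $M_{x,y}=0$ if and only if $f(x,y)=0$. $\mathrm{nrank}(f)$ is the minimal rank among all nondeterministic matrices for $f$. It is known (de Wolf) that $NQ(f)=\lceil\log_2\mathrm{nrank}(f)\rceil+1$ for $f$ not identically 0.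
   Formalization: The bound on NQ(f) is proved with the term (log₂3/log₂6)·log₂fool¹(f) rounded up to an integer; unrounded it is false for every k, since NQ(f) = ⌈k log₂3⌉+1 > k log₂3+1. *)

theory Defs
  imports Complex_Main "HOL-Library.FuncSet" "HOL-Library.Function_Algebras"
begin

section \<open>Matrices with rows and columns indexed by sets\<close>

text \<open>
  A matrix with rows indexed by \<open>X\<close> and columns by \<open>Y\<close> is a function \<open>M\<close>, of which only the
  values \<open>M x y\<close> with \<open>x \<in> X\<close>, \<open>y \<in> Y\<close> matter.  Its rank is the dimension of the span of its
  columns; a column is extended by 0 outside \<open>X\<close>, so that it is a vector of the function space.
\<close>

definition column_on :: "'x set \<Rightarrow> ('x \<Rightarrow> 'y \<Rightarrow> 'f::field) \<Rightarrow> 'y \<Rightarrow> 'x \<Rightarrow> 'f" where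
  "column_on X M y = (\<lambda>x. if x \<in> X then M x y else 0)"

definition rank_on :: "'x set \<Rightarrow> 'y set \<Rightarrow> ('x \<Rightarrow> 'y \<Rightarrow> 'f::field) \<Rightarrow> nat" where
  "rank_on X Y M = vector_space.dim (\<lambda>(c::'f) v x. c * v x) (column_on X M ` Y)"

definition tensor_power :: "nat \<Rightarrow> ('i \<Rightarrow> 'j \<Rightarrow> 'a::comm_ring_1) \<Rightarrow> (nat \<Rightarrow> 'i) \<Rightarrow> (nat \<Rightarrow> 'j) \<Rightarrow> 'a" where
  "tensor_power k M x y = (\<Prod>i\<in>{1..k}. M (x i) (y i))"


section \<open>Fooling sets and nondeterministic matrices\<close>

definition fooling_set1 :: "'x set \<Rightarrow> 'y set \<Rightarrow> ('x \<Rightarrow> 'y \<Rightarrow> int) \<Rightarrow> ('x \<times> 'y) set \<Rightarrow> bool" where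
  "fooling_set1 X Y f F \<longleftrightarrow>
     F \<subseteq> X \<times> Y \<and>
     (\<forall>(x, y)\<in>F. f x y = 1) \<and>
     (\<forall>(x, y)\<in>F. \<forall>(x', y')\<in>F. (x, y) \<noteq> (x', y') \<longrightarrow> f x y' = 0 \<or> f x' y = 0)"

text \<open>Meant for finite \<open>X\<close> and \<open>Y\<close>.\<close>

definition fool1 :: "'x set \<Rightarrow> 'y set \<Rightarrow> ('x \<Rightarrow> 'y \<Rightarrow> int) \<Rightarrow> nat" where
  "fool1 X Y f = Max {card F | F. fooling_set1 X Y f F}"

text \<open>Real matrices are covered as complex ones: their rank is the same over both fields.\<close>

definition nondet_matrix :: "'x set \<Rightarrow> 'y set \<Rightarrow> ('x \<Rightarrow> 'y \<Rightarrow> int) \<Rightarrow> ('x \<Rightarrow> 'y \<Rightarrow> complex) \<Rightarrow> bool" where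
  "nondet_matrix X Y f M \<longleftrightarrow> (\<forall>x\<in>X. \<forall>y\<in>Y. M x y = 0 \<longleftrightarrow> f x y = 0)"


section \<open>Quantum protocols without prior entanglement\<close>

text \<open>
  The qubits are numbered \<open>0, \<dots>, n - 1\<close>.  A set \<open>z\<close> of qubits stands for the computational basis
  state in which exactly the qubits in \<open>z\<close> are 1.  So a state of the qubits in \<open>S\<close> is a
  function on \<open>Pow S\<close>, and an operator on them is a matrix indexed by \<open>Pow S\<close>.
\<close>

type_synonym qstate = "nat set \<Rightarrow> complex"
type_synonym qop = "nat set \<Rightarrow> nat set \<Rightarrow> complex"

definition unit_state :: "nat set \<Rightarrow> qstate \<Rightarrow> bool" where
  "unit_state S \<psi> \<longleftrightarrow> (\<Sum>z\<in>Pow S. (cmod (\<psi> z))\<^sup>2) = 1"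

definition unitary_op :: "nat set \<Rightarrow> qop \<Rightarrow> bool" where
  "unitary_op S U \<longleftrightarrow>
     (\<forall>a\<in>Pow S. \<forall>b\<in>Pow S. (\<Sum>c\<in>Pow S. cnj (U c a) * U c b) = (if a = b then 1 else 0))"

text \<open>The operator \<open>U\<close> on the qubits in \<open>S\<close>, tensored with the identity on all other qubits.\<close>

definition apply_op :: "nat set \<Rightarrow> qop \<Rightarrow> qstate \<Rightarrow> qstate" where
  "apply_op S U \<psi> = (\<lambda>z. \<Sum>c\<in>Pow S. U (z \<inter> S) c * \<psi> (c \<union> (z - S)))"

text \<open>
  Every qubit is held by Alice or by Bob.  Round \<open>t\<close> consists of local unitaries, depending on the
  holder's own input, on Alice's and on Bob's qubits, after which the qubit \<open>sent P ! t\<close> passes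
  from its current holder to the other party.  The number of qubits exchanged is the length of
  \<open>sent P\<close>; either party may send several qubits in a row.  Measurements and other quantum
  operations during the protocol are covered by unitaries acting on additional local qubits.
\<close>

record ('x, 'y) protocol =
  num_qubits :: nat
  alice_start :: "nat set"
  alice_init :: qstate
  bob_init :: qstate
  sent :: "nat list"
  alice_op :: "nat \<Rightarrow> 'x \<Rightarrow> qop"
  bob_op :: "nat \<Rightarrow> 'y \<Rightarrow> qop"

definition qubits :: "('x, 'y) protocol \<Rightarrow> nat set" where
  "qubits P = {..<num_qubits P}"

primrec alice_qubits :: "('x, 'y) protocol \<Rightarrow> nat \<Rightarrow> nat set" where
  "alice_qubits P 0 = alice_start P"
| "alice_qubits P (Suc t) =
     (if sent P ! t \<in> alice_qubits P t then alice_qubits P t - {sent P ! t}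
      else insert (sent P ! t) (alice_qubits P t))"

definition bob_qubits :: "('x, 'y) protocol \<Rightarrow> nat \<Rightarrow> nat set" where
  "bob_qubits P t = qubits P - alice_qubits P t"

text \<open>
  At least one qubit must be sent, since the output is the measured value of the last one sent.
\<close>

definition valid_protocol :: "'x set \<Rightarrow> 'y set \<Rightarrow> ('x, 'y) protocol \<Rightarrow> bool" where
  "valid_protocol X Y P \<longleftrightarrow>
     alice_start P \<subseteq> qubits P \<and>
     sent P \<noteq> [] \<and> set (sent P) \<subseteq> qubits P \<and>
     unit_state (alice_qubits P 0) (alice_init P) \<and>
     unit_state (bob_qubits P 0) (bob_init P) \<and>
     (\<forall>t<length (sent P). \<forall>x\<in>X. unitary_op (alice_qubits P t) (alice_op P t x)) \<and>
     (\<forall>t<length (sent P). \<forall>y\<in>Y. unitary_op (bob_qubits P t) (bob_op P t y))"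

primrec run :: "('x, 'y) protocol \<Rightarrow> 'x \<Rightarrow> 'y \<Rightarrow> nat \<Rightarrow> qstate" where
  "run P x y 0 = (\<lambda>z. alice_init P (z \<inter> alice_qubits P 0) * bob_init P (z \<inter> bob_qubits P 0))"
| "run P x y (Suc t) =
     apply_op (bob_qubits P t) (bob_op P t y)
       (apply_op (alice_qubits P t) (alice_op P t x) (run P x y t))"

definition accept_prob :: "('x, 'y) protocol \<Rightarrow> 'x \<Rightarrow> 'y \<Rightarrow> real" where
  "accept_prob P x y =
     (\<Sum>z | z \<subseteq> qubits P \<and> last (sent P) \<in> z. (cmod (run P x y (length (sent P)) z))\<^sup>2)"

text \<open>
  \<open>NQ\<close> is a number of qubits, hence an integer: for \<open>f\<close> not identically 0 it is the base-2
  logarithm of the nondeterministic rank, rounded up, plus 1.  A bound on that logarithm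
  therefore bounds \<open>NQ\<close> only after the same rounding.
\<close>

definition NQ :: "'x set \<Rightarrow> 'y set \<Rightarrow> ('x \<Rightarrow> 'y \<Rightarrow> int) \<Rightarrow> nat" where
  "NQ X Y f = (LEAST q. \<exists>P. valid_protocol X Y P \<and> length (sent P) = q \<and>
     (\<forall>x\<in>X. \<forall>y\<in>Y. accept_prob P x y > 0 \<longleftrightarrow> f x y = 1))"


section \<open>The matrix and the functions\<close>

definition A :: "nat \<Rightarrow> nat \<Rightarrow> int" where
  "A i j =
    [[ 1, 1, 0,  0,  0, 1],
     [ 0, 1, 0, -1, -1, 0],
     [-1, 1, 1,  0, -1, 0],
     [-1, 0, 1,  1,  0, 0],
     [ 1, 0, 0,  1,  1, 1],
     [ 0, 1, 1,  1,  0, 1]] ! (i - 1) ! (j - 1)"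

definition g :: "nat \<Rightarrow> nat \<Rightarrow> int" where
  "g i j = \<bar>A i j\<bar>"

definition tuples6 :: "nat \<Rightarrow> (nat \<Rightarrow> nat) set" where
  "tuples6 k = {1..k} \<rightarrow>\<^sub>E {1..6}"

definition and_g :: "nat \<Rightarrow> (nat \<Rightarrow> nat) \<Rightarrow> (nat \<Rightarrow> nat) \<Rightarrow> int" where
  "and_g k x y = (\<Prod>i\<in>{1..k}. g (x i) (y i))"

end

(*
  Over the basis columns 1, 2, 3 the matrix factors as A = U V with inner dimension 3, so the
  entries of the k-fold tensor power are inner products of vectors u_x, v_y of dimension 3^k.
  Bob prepares the normalized v_y on n qubits, where 2^n >= 3^k, and sends it to Alice; she flips
  an ancilla if she finds the message in the direction u_x and sends the ancilla as output.
  The acceptance probability is a positive multiple of the square of the entry.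
*)
theory Submission
  imports Defs
begin

subsection \<open>Rank\<close>

text \<open>The columns indexed by \<open>L\<close> are a basis of the column space:
  \<open>V\<close> expresses every column through them, and \<open>W\<close>, a left inverse of the
  submatrix on \<open>L\<close>, makes them independent.\<close>

lemma rank_on_eq_card:
  fixes M :: "'x \<Rightarrow> 'y \<Rightarrow> 'f::field"
  assumes "finite X" "finite L" "L \<subseteq> Y"
    and spanning: "\<And>x y. x \<in> X \<Longrightarrow> y \<in> Y \<Longrightarrow> M x y = (\<Sum>l\<in>L. M x l * V l y)"
    and dual: "\<And>l l'. l \<in> L \<Longrightarrow> l' \<in> L \<Longrightarrow> (\<Sum>x\<in>X. W l x * M x l') = (if l = l' then 1 else 0)"
  shows "rank_on X Y M = card L"
proof -
  interpret vector_space "\<lambda>(c::'f) (v::'x \<Rightarrow> 'f) x. c * v x"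
    by unfold_locales (auto simp: algebra_simps fun_eq_iff)
  have sum_apply: "(\<Sum>a\<in>B. h a) x = (\<Sum>a\<in>B. h a x)" for B and h :: "'b \<Rightarrow> 'x \<Rightarrow> 'f" and x
    by (induction B rule: infinite_finite_induct) auto
  let ?col = "column_on X M"
  have dual_col: "(\<Sum>x\<in>X. W l x * ?col l' x) = (if l = l' then 1 else 0)" if "l \<in> L" "l' \<in> L" for l l'
    using dual[OF that] by (simp add: column_on_def cong: sum.cong)
  \<comment> \<open>Equal columns at distinct indices would pair with \<open>W l\<close> to both 1
    and 0.\<close>
  have inj: "inj_on ?col L"
    by (rule inj_onI) (metis dual_col one_neq_zero)
  have span: "?col ` Y \<subseteq> span (?col ` L)"
  proof safe
    fix y assume "y \<in> Y"
    then have "?col y = (\<Sum>l\<in>L. (\<lambda>x. V l y * ?col l x))"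
      by (auto simp: fun_eq_iff sum_apply column_on_def spanning mult.commute intro!: sum.cong)
    also have "\<dots> \<in> span (?col ` L)"
      by (intro span_sum span_scale span_base) auto
    finally show "?col y \<in> span (?col ` L)" .
  qed
  have indep: "independent (?col ` L)"
  proof (rule independent_if_scalars_zero)
    show "finite (?col ` L)" using \<open>finite L\<close> by simp
    fix c v assume 0: "(\<Sum>v\<in>?col ` L. (\<lambda>x. c v * v x)) = 0" and "v \<in> ?col ` L"
    then obtain l where l: "l \<in> L" "v = ?col l" by auto
    \<comment> \<open>Pairing the vanishing combination with \<open>W l\<close> isolates the
      coefficient of column \<open>l\<close>.\<close>
    have "0 = (\<Sum>x\<in>X. W l x * (\<Sum>v\<in>?col ` L. (\<lambda>x. c v * v x)) x)"
      by (simp add: 0)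
    also have "\<dots> = (\<Sum>x\<in>X. W l x * (\<Sum>l'\<in>L. c (?col l') * ?col l' x))"
      by (simp add: sum_apply sum.reindex[OF inj])
    also have "\<dots> = (\<Sum>l'\<in>L. c (?col l') * (\<Sum>x\<in>X. W l x * ?col l' x))"
      unfolding sum_distrib_left by (subst sum.swap) (simp add: mult.left_commute)
    also have "\<dots> = (\<Sum>l'\<in>L. if l = l' then c (?col l') else 0)"
      by (rule sum.cong) (auto simp: dual_col l(1))
    also have "\<dots> = c v" using l \<open>finite L\<close> by simp
    finally show "c v = 0" by simp
  qed
  show ?thesis
    unfolding rank_on_def
    using dim_unique[OF image_mono[OF \<open>L \<subseteq> Y\<close>] span indep refl] card_image[OF inj] by simp
qed

section \<open>Tensor powers of matrices\<close>

text \<open>The mixed-product rule: a product over \<open>k\<close> coordinates of sums over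
  \<open>L\<close> expands into one sum over all tuples in \<open>L\<close>.\<close>

lemma tensor_power_matrix_mult:
  assumes "finite L"
  shows "(\<Sum>z\<in>{1..k} \<rightarrow>\<^sub>E L. tensor_power k M x z * tensor_power k N z y)
    = tensor_power k (\<lambda>i j. \<Sum>l\<in>L. M i l * N l j) x y"
  using assms by (simp add: tensor_power_def prod_sum_PiE prod.distrib)

text \<open>For distinct tuples a factor at a differing coordinate is zero; extensionality places
  such a coordinate in \<open>{1..k}\<close>.\<close>

lemma tensor_power_identity:
  assumes "\<And>l l'. l \<in> L \<Longrightarrow> l' \<in> L \<Longrightarrow> M l l' = (if l = l' then 1 else 0)"
    and "x \<in> {1..k} \<rightarrow>\<^sub>E L" "y \<in> {1..k} \<rightarrow>\<^sub>E L"
  shows "tensor_power k M x y = (if x = y then 1 else 0)"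
proof (cases "x = y")
  case True
  with assms show ?thesis by (auto simp: tensor_power_def PiE_iff intro!: prod.neutral)
next
  case False
  then obtain i where "i \<in> {1..k}" "x i \<noteq> y i" using PiE_ext[OF assms(2,3)] by blast
  with assms False show ?thesis by (auto simp: tensor_power_def PiE_iff intro!: prod_zero bexI[of _ i])
qed

lemma tensor_power_cong:
  assumes "\<And>i j. i \<in> I \<Longrightarrow> j \<in> J \<Longrightarrow> M i j = N i j"
    and "x \<in> {1..k} \<rightarrow>\<^sub>E I" "y \<in> {1..k} \<rightarrow>\<^sub>E J"
  shows "tensor_power k M x y = tensor_power k N x y"
  using assms by (auto simp: tensor_power_def PiE_iff intro!: prod.cong)

text \<open>Both certificates pass to tensor powers: by the mixed-product rule, the tensor powers of
  \<open>V\<close> and \<open>W\<close> serve the basis columns indexed by tuples in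
  \<open>L\<close>.\<close>

lemma rank_on_tensor_power:
  fixes M :: "'i \<Rightarrow> 'j \<Rightarrow> 'f::field"
  assumes "finite I" "finite L" "L \<subseteq> J"
    and spanning: "\<And>i j. i \<in> I \<Longrightarrow> j \<in> J \<Longrightarrow> M i j = (\<Sum>l\<in>L. M i l * V l j)"
    and dual: "\<And>l l'. l \<in> L \<Longrightarrow> l' \<in> L \<Longrightarrow> (\<Sum>i\<in>I. W l i * M i l') = (if l = l' then 1 else 0)"
  shows "rank_on ({1..k} \<rightarrow>\<^sub>E I) ({1..k} \<rightarrow>\<^sub>E J) (tensor_power k M) = card L ^ k"
proof -
  have "rank_on ({1..k} \<rightarrow>\<^sub>E I) ({1..k} \<rightarrow>\<^sub>E J) (tensor_power k M) = card ({1..k} \<rightarrow>\<^sub>E L)"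
  proof (rule rank_on_eq_card)
    show "finite ({1..k} \<rightarrow>\<^sub>E I)" "finite ({1..k} \<rightarrow>\<^sub>E L)"
      using assms by (simp_all add: finite_PiE)
    show "({1..k} \<rightarrow>\<^sub>E L) \<subseteq> ({1..k} \<rightarrow>\<^sub>E J)" using \<open>L \<subseteq> J\<close> by (intro PiE_mono)
    show "tensor_power k M x y = (\<Sum>l\<in>{1..k} \<rightarrow>\<^sub>E L. tensor_power k M x l * tensor_power k V l y)"
      if "x \<in> {1..k} \<rightarrow>\<^sub>E I" "y \<in> {1..k} \<rightarrow>\<^sub>E J" for x y
      unfolding tensor_power_matrix_mult[OF \<open>finite L\<close>]
      by (rule tensor_power_cong[OF spanning that])
    show "(\<Sum>x\<in>{1..k} \<rightarrow>\<^sub>E I. tensor_power k W l x * tensor_power k M x l') = (if l = l' then 1 else 0)"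
      if "l \<in> {1..k} \<rightarrow>\<^sub>E L" "l' \<in> {1..k} \<rightarrow>\<^sub>E L" for l l'
      unfolding tensor_power_matrix_mult[OF \<open>finite I\<close>]
      by (rule tensor_power_identity[OF dual that])
  qed
  then show ?thesis by (simp add: card_PiE)
qed

subsection \<open>Inner product protocol\<close>

text \<open>For \<open>w = 0\<close> this is the identity, by \<open>x / 0 = 0\<close>.\<close>

definition reflection :: "nat set \<Rightarrow> (nat set \<Rightarrow> real) \<Rightarrow> qop" where
  "reflection S w a b =
     complex_of_real ((if a = b then 1 else 0) - 2 * w a * w b / (\<Sum>c\<in>Pow S. (w c)\<^sup>2))"

lemma reflection_apply:
  assumes "finite S" "a \<in> Pow S"
  shows "(\<Sum>c\<in>Pow S. reflection S w a c * \<psi> c)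
    = \<psi> a - complex_of_real (2 * w a / (\<Sum>c\<in>Pow S. (w c)\<^sup>2)) * (\<Sum>c\<in>Pow S. w c * \<psi> c)"
proof -
  define N where "N = (\<Sum>c\<in>Pow S. (w c)\<^sup>2)"
  have *: "reflection S w a c * \<psi> c = (if a = c then \<psi> c else 0)
      - complex_of_real (2 * w a / N) * (w c * \<psi> c)" for c
    unfolding reflection_def N_def [symmetric] by (simp add: algebra_simps)
  have "(\<Sum>c\<in>Pow S. reflection S w a c * \<psi> c) = (\<Sum>c\<in>Pow S. if a = c then \<psi> c else 0)
      - complex_of_real (2 * w a / N) * (\<Sum>c\<in>Pow S. w c * \<psi> c)"
    by (simp only: * sum_subtractf sum_distrib_left)
  also have "(\<Sum>c\<in>Pow S. if a = c then \<psi> c else 0) = \<psi> a"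
    using assms by simp
  finally show ?thesis by (simp only: N_def)
qed

text \<open>A Householder reflection is real and symmetric, hence its own adjoint, and it is an
  involution.\<close>

lemma unitary_reflection:
  assumes "finite S"
  shows "unitary_op S (reflection S w)"
proof -
  define N where "N = (\<Sum>c\<in>Pow S. (w c)\<^sup>2)"
  have N_of_real: "complex_of_real N = (\<Sum>c\<in>Pow S. complex_of_real (w c) * complex_of_real (w c))"
    by (simp add: N_def power2_eq_square)
  have "(\<Sum>c\<in>Pow S. cnj (reflection S w c a) * reflection S w c b) = (if a = b then 1 else 0)"
    if "a \<in> Pow S" "b \<in> Pow S" for a b
  proof -
    have "cnj (reflection S w c a) = reflection S w a c" for c
      by (simp add: reflection_def mult.commute mult.left_commute)
    then have "(\<Sum>c\<in>Pow S. cnj (reflection S w c a) * reflection S w c b)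
      = reflection S w a b - complex_of_real (2 * w a / N) * (\<Sum>c\<in>Pow S. w c * reflection S w c b)"
      using reflection_apply[OF assms that(1), of w "\<lambda>c. reflection S w c b"] by (simp add: N_def)
    \<comment> \<open>By symmetry this is the \<open>b\<close> entry of the reflection applied to
      \<open>w\<close>, which is \<open>- w b\<close> unless \<open>N = 0\<close>.\<close>
    also have "(\<Sum>c\<in>Pow S. w c * reflection S w c b)
      = (\<Sum>c\<in>Pow S. reflection S w b c * w c)"
      by (intro sum.cong) (auto simp: reflection_def algebra_simps)
    also have "\<dots> = complex_of_real (w b - 2 * w b / N * N)"
      unfolding reflection_apply[OF assms that(2)] N_def [symmetric] N_of_real [symmetric] by simp
    finally show ?thesis
      by (cases "N = 0") (auto simp: reflection_def N_def[symmetric])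
  qed
  then show ?thesis by (simp add: unitary_op_def)
qed

text \<open>Reflecting in the difference of two vectors of equal norm swaps them. Here these are
  \<open>v\<close> and \<open>r\<close> times the zero basis state, so the zero state goes to
  \<open>v\<close> normalized; this is Bob's state preparation.\<close>

lemma reflection_basis_state:
  fixes v :: "nat set \<Rightarrow> real"
  assumes "finite S" "z \<in> Pow S" "v z \<noteq> 0" "a \<in> Pow S"
  defines "r \<equiv> sqrt (\<Sum>c\<in>Pow S. (v c)\<^sup>2)"
  shows "r > 0" "reflection S (\<lambda>c. (if c = {} then r else 0) - v c) a {} = complex_of_real (v a / r)"
proof -
  let ?w = "\<lambda>c. (if c = {} then r else 0) - v c"
  define N where "N = (\<Sum>c\<in>Pow S. (?w c)\<^sup>2)"
  have "(\<Sum>c\<in>Pow S. (v c)\<^sup>2) > 0"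
    using assms by (intro sum_pos2[of _ z]) auto
  then show "r > 0" by (simp add: r_def)
  have r2: "r\<^sup>2 = (\<Sum>c\<in>Pow S. (v c)\<^sup>2)"
    by (simp add: r_def sum_nonneg)
  have "(?w c)\<^sup>2 = (v c)\<^sup>2 + (if {} = c then r\<^sup>2 - 2 * r * v c else 0)" for c
    by (auto simp: power2_eq_square algebra_simps)
  \<comment> \<open>Both vectors have norm \<open>r\<close>, so the squared norm of their difference
    is \<open>2 * r\<^sup>2\<close> minus twice their inner product. The factor
    \<open>r - v {}\<close> cancels against \<open>?w {}\<close> below.\<close>
  then have N: "N = 2 * r * (r - v {})"
    using \<open>finite S\<close> by (simp add: N_def sum.distrib r2[symmetric]) (simp add: algebra_simps power2_eq_square)
  have "(if a = {} then 1 else 0) - 2 * ?w a * ?w {} / N = v a / r"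
  proof (cases "N = 0")
    \<comment> \<open>Here \<open>v\<close> is already \<open>r\<close> times the zero basis state,
      and the reflection is the identity.\<close>
    case True
    then have "\<forall>c\<in>Pow S. (?w c)\<^sup>2 = 0"
      unfolding N_def using \<open>finite S\<close> by (subst (asm) sum_nonneg_eq_0_iff) auto
    then have "?w a = 0" using assms(4) by (auto split: if_splits)
    then show ?thesis using \<open>r > 0\<close> by (auto split: if_splits)
  next
    case False
    then have "2 * ?w a * ?w {} / N = ?w a / r"
      using \<open>r > 0\<close> by (auto simp: N field_simps)
    then show ?thesis using \<open>r > 0\<close> by (auto simp: diff_divide_distrib)
  qed
  then show "reflection S ?w a {} = complex_of_real (v a / r)"
    by (simp add: reflection_def N_def)
qed

section \<open>The identity operation and the zero state\<close>

definition id_op :: qop where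
  "id_op a b = (if a = b then 1 else 0)"

lemma unitary_id_op:
  assumes "finite S"
  shows "unitary_op S id_op"
proof -
  have "(\<Sum>c\<in>Pow S. cnj (id_op c a) * id_op c b) = (\<Sum>c\<in>Pow S. if a = c then id_op a b else 0)"
    for a b
    by (intro sum.cong) (auto simp: id_op_def)
  then show ?thesis using assms by (simp add: unitary_op_def id_op_def)
qed

lemma apply_id_op:
  assumes "finite S"
  shows "apply_op S id_op \<psi> = \<psi>"
proof
  fix z
  have "apply_op S id_op \<psi> z = (\<Sum>c\<in>Pow S. if z \<inter> S = c then \<psi> (c \<union> (z - S)) else 0)"
    unfolding apply_op_def by (intro sum.cong) (auto simp: id_op_def)
  also have "\<dots> = \<psi> (z \<inter> S \<union> (z - S))" using assms by simp
  finally show "apply_op S id_op \<psi> z = \<psi> z" by (simp add: Int_Diff_Un)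
qed

definition basis_zero :: qstate where
  "basis_zero z = (if z = {} then 1 else 0)"

lemma unit_basis_zero:
  assumes "finite S"
  shows "unit_state S basis_zero"
proof -
  have "(\<Sum>z\<in>Pow S. (cmod (basis_zero z))\<^sup>2) = (\<Sum>z\<in>Pow S. if {} = z then 1 else 0)"
    by (intro sum.cong) (auto simp: basis_zero_def)
  then show ?thesis using assms by (simp add: unit_state_def)
qed

text \<open>
  On the message and the ancilla, Alice's operator is \<open>P \<otimes> NOT + (1 - P) \<otimes> 1\<close>, where \<open>P\<close> projects
  onto her vector \<open>u\<close>: this is the reflection in \<open>u \<otimes> (|0> - |1>)\<close>.
\<close>

definition inner_protocol ::
    "nat \<Rightarrow> ('x \<Rightarrow> nat set \<Rightarrow> real) \<Rightarrow> ('y \<Rightarrow> nat set \<Rightarrow> real) \<Rightarrow> ('x, 'y) protocol" where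
  "inner_protocol n u v = \<lparr>
     num_qubits = Suc n,
     alice_start = {n},
     alice_init = basis_zero,
     bob_init = basis_zero,
     sent = [0..<Suc n],
     alice_op = (\<lambda>t x. if t = n
       then reflection {..n} (\<lambda>c. if n \<in> c then - u x (c - {n}) else u x c) else id_op),
     bob_op = (\<lambda>t y. if t = 0
       then reflection {..<n}
         (\<lambda>c. (if c = {} then sqrt (\<Sum>c\<in>Pow {..<n}. (v y c)\<^sup>2) else 0) - v y c) else id_op)\<rparr>"

text \<open>Qubit \<open>n\<close> is the ancilla and starts with Alice. The qubits below
  \<open>n\<close> are the message: they start with Bob and travel in order, one per round, so the
  first \<open>t\<close> have arrived before round \<open>t\<close>.\<close>

lemma alice_qubits_inner_protocol:
  "t \<le> n \<Longrightarrow> alice_qubits (inner_protocol n u v) t = insert n {..<t}"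
proof (induction t)
  case 0
  then show ?case by (simp add: inner_protocol_def)
next
  case (Suc t)
  then have "sent (inner_protocol n u v) ! t = t"
    by (simp add: inner_protocol_def nth_append)
  moreover have "alice_qubits (inner_protocol n u v) t = insert n {..<t}" "t \<noteq> n"
    using Suc by simp_all
  ultimately show ?case by (simp add: lessThan_Suc insert_commute)
qed

lemma bob_qubits_inner_protocol:
  "t \<le> n \<Longrightarrow> bob_qubits (inner_protocol n u v) t = {t..<n}"
proof -
  assume "t \<le> n"
  have "qubits (inner_protocol n u v) = {..<Suc n}"
    by (simp add: qubits_def inner_protocol_def)
  then have "bob_qubits (inner_protocol n u v) t = {..<Suc n} - insert n {..<t}"
    by (simp only: bob_qubits_def alice_qubits_inner_protocol[OF \<open>t \<le> n\<close>])
  also have "\<dots> = {t..<n}" using \<open>t \<le> n\<close> by auto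
  finally show ?thesis .
qed

text \<open>Every local operation is the identity or a reflection. The registers of the two
  reflections match what their owners hold: Bob has the whole message in round 0, Alice has all
  qubits in round \<open>n\<close>.\<close>

lemma valid_inner_protocol: "valid_protocol X Y (inner_protocol n u v)"
proof -
  let ?P = "inner_protocol n u v"
  have len: "length (sent ?P) = Suc n"
    and init: "alice_init ?P = basis_zero" "bob_init ?P = basis_zero"
    and ops: "alice_start ?P \<subseteq> qubits ?P" "sent ?P \<noteq> []" "set (sent ?P) \<subseteq> qubits ?P"
    by (auto simp: inner_protocol_def qubits_def)
  have "unitary_op (alice_qubits ?P t) (alice_op ?P t x)" if "t \<le> n" for t x
    using that by (auto simp: alice_qubits_inner_protocol unitary_id_op)
      (auto simp: inner_protocol_def unitary_id_op unitary_reflection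
        lessThan_Suc[symmetric] lessThan_Suc_atMost)
  moreover have "unitary_op (bob_qubits ?P t) (bob_op ?P t y)" if "t \<le> n" for t y
    using that by (auto simp: bob_qubits_inner_protocol unitary_id_op)
      (auto simp: inner_protocol_def unitary_id_op unitary_reflection atLeast0LessThan)
  moreover have "unit_state (alice_qubits ?P 0) basis_zero" "unit_state (bob_qubits ?P 0) basis_zero"
    by (simp_all only: alice_qubits_inner_protocol[OF le0] bob_qubits_inner_protocol[OF le0])
      (auto intro!: unit_basis_zero)
  ultimately show ?thesis
    unfolding valid_protocol_def len init less_Suc_eq_le using ops by blast
qed

text \<open>Bob's reflection in round 0 turns the zero message into \<open>v y\<close> normalized;
  the other operations before round \<open>n\<close> are identities, so this state persists with
  ancilla 0.\<close>

lemma run_inner_protocol: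
  assumes "z0 \<in> Pow {..<n}" "v y z0 \<noteq> 0" "t < n"
  shows "run (inner_protocol n u v) x y (Suc t) =
    (\<lambda>z. if n \<in> z then 0
       else complex_of_real (v y (z \<inter> {..<n}) / sqrt (\<Sum>c\<in>Pow {..<n}. (v y c)\<^sup>2)))"
  using assms(3)
proof (induction t)
  case 0
  let ?P = "inner_protocol n u v"
  let ?w = "\<lambda>c. (if c = {} then sqrt (\<Sum>c\<in>Pow {..<n}. (v y c)\<^sup>2) else 0) - v y c"
  have q: "alice_qubits ?P 0 = {n}" "bob_qubits ?P 0 = {..<n}"
    by (simp_all add: alice_qubits_inner_protocol bob_qubits_inner_protocol atLeast0LessThan
        del: alice_qubits.simps)
  have ops: "alice_op ?P 0 x = id_op" "bob_op ?P 0 y = reflection {..<n} ?w"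
    and init: "alice_init ?P = basis_zero" "bob_init ?P = basis_zero"
    using 0 by (simp_all add: inner_protocol_def)
  have run0: "run ?P x y 0 = (\<lambda>z. if z \<inter> {..n} = {} then 1 else 0)"
    unfolding run.simps q init by (force simp: basis_zero_def fun_eq_iff le_less)
  have "run ?P x y (Suc 0) = apply_op {..<n} (reflection {..<n} ?w) (run ?P x y 0)"
    unfolding run.simps(2) q ops by (simp add: apply_id_op)
  also have "\<dots> = (\<lambda>z. if n \<in> z then 0 else reflection {..<n} ?w (z \<inter> {..<n}) {})"
  proof
    fix z
    \<comment> \<open>The initial amplitude vanishes unless all \<open>n + 1\<close> qubits are 0,
      so only \<open>c = {}\<close> survives, and only if \<open>z\<close> does not contain the
      ancilla.\<close>
    have "apply_op {..<n} (reflection {..<n} ?w) (run ?P x y 0) z =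
      (\<Sum>c\<in>Pow {..<n}. if {} = c then (if n \<in> z then 0 else reflection {..<n} ?w (z \<inter> {..<n}) {}) else 0)"
      unfolding apply_op_def run0
    proof (intro sum.cong refl)
      fix c assume "c \<in> Pow {..<n}"
      then have "(c \<union> (z - {..<n})) \<inter> {..n} = {} \<longleftrightarrow> c = {} \<and> n \<notin> z"
        unfolding lessThan_Suc_atMost[symmetric] lessThan_Suc by blast
      then show "reflection {..<n} ?w (z \<inter> {..<n}) c * (if (c \<union> (z - {..<n})) \<inter> {..n} = {} then 1 else 0)
        = (if {} = c then if n \<in> z then 0 else reflection {..<n} ?w (z \<inter> {..<n}) {} else 0)"
        by (cases "c = {}"; cases "n \<in> z") simp_all
    qed
    then show "apply_op {..<n} (reflection {..<n} ?w) (run ?P x y 0) z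
      = (if n \<in> z then 0 else reflection {..<n} ?w (z \<inter> {..<n}) {})"
      by simp
  qed
  finally show ?case
    using reflection_basis_state(2)[of "{..<n}" z0 "v y", OF _ assms(1,2)]
    by (simp add: fun_eq_iff del: run.simps)
next
  case (Suc t)
  let ?P = "inner_protocol n u v"
  have ops: "alice_op ?P (Suc t) x = id_op" "bob_op ?P (Suc t) y = id_op"
    using Suc.prems by (simp_all add: inner_protocol_def)
  have fin: "finite (alice_qubits ?P (Suc t))" "finite (bob_qubits ?P (Suc t))"
    using Suc.prems
    by (simp_all add: alice_qubits_inner_protocol bob_qubits_inner_protocol del: alice_qubits.simps)
  have "run ?P x y (Suc (Suc t)) = run ?P x y (Suc t)"
    unfolding run.simps(2)[of _ _ _ "Suc t"] ops by (simp only: apply_id_op fin)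
  also have "\<dots> = (\<lambda>z. if n \<in> z then 0
      else complex_of_real (v y (z \<inter> {..<n}) / sqrt (\<Sum>c\<in>Pow {..<n}. (v y c)\<^sup>2)))"
    using Suc.prems by (intro Suc.IH) simp
  finally show ?case .
qed

text \<open>Alice's reflection moves amplitude to ancilla value 1 along \<open>u x\<close>, in
  proportion to the inner product. As \<open>n > 0\<close>, Bob's preparation lies in an earlier
  round than her reflection.\<close>

lemma accept_prob_inner_protocol:
  assumes "n > 0" "z0 \<in> Pow {..<n}" "v y z0 \<noteq> 0"
  shows "accept_prob (inner_protocol n u v) x y > 0 \<longleftrightarrow> (\<Sum>z\<in>Pow {..<n}. u x z * v y z) \<noteq> 0"
proof -
  let ?P = "inner_protocol n u v"
  let ?w = "\<lambda>c. if n \<in> c then - u x (c - {n}) else u x c"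
  define r where "r = sqrt (\<Sum>c\<in>Pow {..<n}. (v y c)\<^sup>2)"
  define N where "N = (\<Sum>c\<in>Pow {..n}. (?w c)\<^sup>2)"
  define ip where "ip = (\<Sum>z\<in>Pow {..<n}. u x z * v y z)"
  define \<psi> where "\<psi> = run ?P x y n"
  have "r > 0" unfolding r_def using assms(2,3) by (intro reflection_basis_state(1)[of _ z0]) auto
  have \<psi>: "\<psi> = (\<lambda>z. if n \<in> z then 0 else complex_of_real (v y (z \<inter> {..<n}) / r))"
    using run_inner_protocol[of z0 n v y "n - 1" u x, OF assms(2,3)] \<open>n > 0\<close>
    unfolding \<psi>_def r_def by simp
  have q: "alice_qubits ?P n = {..n}" "bob_qubits ?P n = {}"
    by (auto simp: alice_qubits_inner_protocol bob_qubits_inner_protocol)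
  have ops: "alice_op ?P n x = reflection {..n} ?w" "bob_op ?P n y = id_op"
    using \<open>n > 0\<close> by (simp_all add: inner_protocol_def)
  have sent: "sent ?P = [0..<Suc n]" and qs: "qubits ?P = {..n}"
    by (simp_all add: inner_protocol_def qubits_def lessThan_Suc_atMost)
  \<comment> \<open>The ancilla is still 0, so the half of \<open>?w\<close> with the minus sign
    contributes nothing.\<close>
  have "(\<Sum>c\<in>Pow {..n}. ?w c * \<psi> c) = (\<Sum>c\<in>Pow {..<n}. ?w c * \<psi> c)"
    by (intro sum.mono_neutral_right) (auto simp: \<psi> le_less)
  also have "\<dots> = (\<Sum>c\<in>Pow {..<n}. complex_of_real (u x c * v y c / r))"
    by (intro sum.cong) (auto simp: \<psi> Int_absorb2)
  also have "\<dots> = complex_of_real (ip / r)"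
    by (simp only: ip_def sum_divide_distrib of_real_sum)
  finally have w\<psi>: "(\<Sum>c\<in>Pow {..n}. ?w c * \<psi> c) = complex_of_real (ip / r)" .
  \<comment> \<open>With \<open>n\<close> in \<open>z\<close> the old amplitude is 0 and
    \<open>?w z\<close> is \<open>- u x (z - {n})\<close>; the two minus signs cancel.\<close>
  have final: "run ?P x y (Suc n) z = complex_of_real (2 * u x (z - {n}) / N * (ip / r))"
    if "z \<subseteq> {..n}" "n \<in> z" for z
  proof -
    have "run ?P x y (Suc n) z = (\<Sum>c\<in>Pow {..n}. reflection {..n} ?w (z \<inter> {..n}) c * \<psi> (c \<union> (z - {..n})))"
      unfolding run.simps q ops \<psi>_def by (simp add: apply_id_op) (simp add: apply_op_def)
    also have "\<dots> = (\<Sum>c\<in>Pow {..n}. reflection {..n} ?w z c * \<psi> c)"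
      using that by (intro sum.cong) (auto simp: Int_absorb2 Diff_eq_empty_iff[THEN iffD2])
    also have "\<dots> = \<psi> z - complex_of_real (2 * ?w z / N) * complex_of_real (ip / r)"
      using reflection_apply[of "{..n}" z ?w \<psi>] that by (simp only: w\<psi> N_def) simp
    finally show ?thesis using that by (simp add: \<psi>)
  qed
  have "accept_prob ?P x y > 0 \<longleftrightarrow> (\<exists>z. z \<subseteq> {..n} \<and> n \<in> z \<and> run ?P x y (Suc n) z \<noteq> 0)"
  proof -
    have fin: "finite {z. z \<subseteq> {..n} \<and> n \<in> z}"
      by (rule finite_subset[of _ "Pow {..n}"]) auto
    have acc: "accept_prob ?P x y = (\<Sum>z | z \<subseteq> {..n} \<and> n \<in> z. (cmod (run ?P x y (Suc n) z))\<^sup>2)"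
      unfolding accept_prob_def sent qs by simp
    have "accept_prob ?P x y \<ge> 0" unfolding acc by (intro sum_nonneg) auto
    then have "accept_prob ?P x y > 0 \<longleftrightarrow> accept_prob ?P x y \<noteq> 0" by linarith
    also have "\<dots> \<longleftrightarrow> (\<exists>z. z \<subseteq> {..n} \<and> n \<in> z \<and> run ?P x y (Suc n) z \<noteq> 0)"
      unfolding acc by (subst sum_nonneg_eq_0_iff[OF fin]) auto
    finally show ?thesis .
  qed
  also have "\<dots> \<longleftrightarrow> ip \<noteq> 0"
  proof
    assume "\<exists>z. z \<subseteq> {..n} \<and> n \<in> z \<and> run ?P x y (Suc n) z \<noteq> 0"
    then show "ip \<noteq> 0" using final by fastforce
  next
    assume "ip \<noteq> 0"
    \<comment> \<open>A nonzero inner product forces a nonzero entry of \<open>u x\<close>; setting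
      the ancilla in that basis state gives an accepting state of nonzero amplitude.\<close>
    then obtain z where z: "z \<subseteq> {..<n}" "u x z \<noteq> 0"
      unfolding ip_def by (metis (no_types, lifting) PowD mult_zero_left sum.neutral)
    have "n \<notin> z" using z(1) by auto
    have "N > 0"
      unfolding N_def using z \<open>n \<notin> z\<close> by (intro sum_pos2[of _ z]) auto
    then have "run ?P x y (Suc n) (insert n z) \<noteq> 0"
      using z \<open>n \<notin> z\<close> \<open>ip \<noteq> 0\<close> \<open>r > 0\<close> by (subst final) (auto simp del: run.simps)
    moreover have "insert n z \<subseteq> {..n}" using z by auto
    ultimately show "\<exists>z. z \<subseteq> {..n} \<and> n \<in> z \<and> run ?P x y (Suc n) z \<noteq> 0" by blast
  qed
  finally show ?thesis by (simp add: ip_def)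
qed

section \<open>From factorizations to protocols\<close>

text \<open>\<open>NQ\<close> is a minimum, so one protocol suffices. The index set \<open>D\<close>
  embeds into the basis states of \<open>n\<close> message qubits, \<open>nonzero\<close> lets Bob
  normalize his vector, and the additional qubit is the ancilla carrying the output.\<close>

lemma NQ_le:
  fixes u :: "'x \<Rightarrow> 'd \<Rightarrow> real" and v :: "'y \<Rightarrow> 'd \<Rightarrow> real"
  assumes "finite D" "card D \<le> 2 ^ n" "n > 0"
    and factorization: "\<And>x y. x \<in> X \<Longrightarrow> y \<in> Y \<Longrightarrow> f x y = 1 \<longleftrightarrow> (\<Sum>d\<in>D. u x d * v y d) \<noteq> 0"
    and nonzero: "\<And>y. y \<in> Y \<Longrightarrow> \<exists>d\<in>D. v y d \<noteq> 0"
  shows "NQ X Y f \<le> n + 1"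
proof -
  have "card D \<le> card (Pow {..<n})" using assms(2) by (simp add: card_Pow)
  then obtain e where e: "e ` D \<subseteq> Pow {..<n}" "inj_on e D"
    using card_le_inj[OF \<open>finite D\<close>, of "Pow {..<n}"] by auto
  \<comment> \<open>Extension by zero along the injection \<open>e\<close> preserves inner
    products.\<close>
  define pull :: "('d \<Rightarrow> real) \<Rightarrow> nat set \<Rightarrow> real" where
    "pull h z = (if z \<in> e ` D then h (the_inv_into D e z) else 0)" for h z
  have pull_e: "pull h (e d) = h d" if "d \<in> D" for h d
    using that e(2) by (simp add: pull_def the_inv_into_f_f)
  have inner: "(\<Sum>z\<in>Pow {..<n}. pull h z * pull h' z) = (\<Sum>d\<in>D. h d * h' d)" for h h'
  proof -
    have "(\<Sum>z\<in>Pow {..<n}. pull h z * pull h' z) = (\<Sum>z\<in>e ` D. pull h z * pull h' z)"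
      using e(1) by (intro sum.mono_neutral_right) (auto simp: pull_def)
    then show ?thesis by (simp add: sum.reindex[OF e(2)] pull_e)
  qed
  let ?P = "inner_protocol n (\<lambda>x. pull (u x)) (\<lambda>y. pull (v y))"
  have "accept_prob ?P x y > 0 \<longleftrightarrow> f x y = 1" if "x \<in> X" "y \<in> Y" for x y
  proof -
    obtain d where "d \<in> D" "v y d \<noteq> 0" using nonzero \<open>y \<in> Y\<close> by blast
    then have "e d \<in> Pow {..<n}" "pull (v y) (e d) \<noteq> 0" using e(1) by (auto simp: pull_e)
    from accept_prob_inner_protocol[where u = "\<lambda>x. pull (u x)" and v = "\<lambda>y. pull (v y)" and x = x and y = y,
        OF \<open>n > 0\<close> this] show ?thesis
      using factorization that by (simp add: inner)
  qed
  moreover have "length (sent ?P) = n + 1" by (simp add: inner_protocol_def)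
  ultimately show ?thesis
    unfolding NQ_def using valid_inner_protocol by (intro Least_le) blast
qed

subsection \<open>The function g and its powers\<close>

lemma atLeastAtMost_1_6: "{1..6} = {1, 2, 3, 4, 5, 6::nat}"
  by auto

lemma g_binary:
  assumes "i \<in> {1..6}" "j \<in> {1..6}"
  shows "g i j \<in> {0, 1}"
  using assms unfolding atLeastAtMost_1_6
  by (elim insertE emptyE; simp add: g_def A_def)

lemma g_diag:
  assumes "i \<in> {1..6}"
  shows "g i i = 1"
  using assms unfolding atLeastAtMost_1_6
  by (elim insertE emptyE; simp add: g_def A_def)

lemma g_off_diag:
  assumes "i \<in> {1..6}" "j \<in> {1..6}" "i \<noteq> j"
  shows "g i j = 0 \<or> g j i = 0"
  using assms unfolding atLeastAtMost_1_6
  by (elim insertE emptyE; simp add: g_def A_def)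

text \<open>On columns 1, 2, 3, row 5, row 2 and row 6 minus row 2 of \<open>A\<close> are the three
  unit vectors. Over all columns, the same combinations give the coordinates of each column in the
  basis of columns 1, 2, 3.\<close>

definition A_coeff :: "nat \<Rightarrow> nat \<Rightarrow> int" where
  "A_coeff l j = (if l = 1 then A 5 j else if l = 2 then A 2 j else A 6 j - A 2 j)"

lemma A_factorization:
  assumes "i \<in> {1..6}" "j \<in> {1..6}"
  shows "A i j = (\<Sum>l\<in>{1, 2, 3}. A i l * A_coeff l j)"
  using assms unfolding atLeastAtMost_1_6
  by (elim insertE emptyE; simp add: A_coeff_def A_def)

text \<open>The row combinations of \<open>A_coeff\<close> as a matrix: a left inverse of the first
  three columns of \<open>A\<close>.\<close>

definition A_dual :: "nat \<Rightarrow> nat \<Rightarrow> int" where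
  "A_dual l i = (if l = 1 then of_bool (i = 5) else if l = 2 then of_bool (i = 2)
     else of_bool (i = 6) - of_bool (i = 2))"

lemma A_dual:
  assumes "l \<in> {1, 2, 3}" "l' \<in> {1, 2, 3}"
  shows "(\<Sum>i\<in>{1..6}. A_dual l i * A i l') = (if l = l' then 1 else 0)"
  using assms unfolding atLeastAtMost_1_6
  by (elim insertE emptyE; simp add: A_dual_def A_def)

section \<open>Fooling sets\<close>

text \<open>A fooling set has at most one member per row: for two members in the same row, the
  crossed entries are the members' own entries, which equal 1.\<close>

lemma fooling_set1_card_le:
  assumes "fooling_set1 X Y f F" "finite X"
  shows "card F \<le> card X"
proof -
  have "inj_on fst F"
  proof (rule inj_onI)
    fix p q assume pq: "p \<in> F" "q \<in> F" "fst p = fst q"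
    obtain x y y' where eq: "p = (x, y)" "q = (x, y')" using pq(3) by (metis prod.collapse)
    have "f x y = 1" "f x y' = 1"
      using assms(1) pq unfolding fooling_set1_def eq by auto
    moreover have "p \<noteq> q \<longrightarrow> f x y' = 0 \<or> f x y = 0"
      using assms(1) pq(1,2) unfolding fooling_set1_def eq by blast
    ultimately show "p = q" by auto
  qed
  moreover have "fst ` F \<subseteq> X"
    using assms(1) unfolding fooling_set1_def by auto
  ultimately show ?thesis using assms(2) by (rule card_inj_on_le)
qed

lemma fool1_eq_card:
  assumes "fooling_set1 X Y f F" "finite X" "card F = card X"
  shows "fool1 X Y f = card X"
  unfolding fool1_def
proof (rule Max_eqI)
  have "{card F |F. fooling_set1 X Y f F} \<subseteq> {..card X}"
    using fooling_set1_card_le[OF _ \<open>finite X\<close>] by auto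
  then show "finite {card F |F. fooling_set1 X Y f F}"
    using finite_subset by blast
  show "m \<le> card X" if "m \<in> {card F |F. fooling_set1 X Y f F}" for m
    using that fooling_set1_card_le[OF _ \<open>finite X\<close>] by auto
  show "card X \<in> {card F |F. fooling_set1 X Y f F}"
    using assms by (metis (mono_tags, lifting) mem_Collect_eq)
qed

lemma card_diagonal: "card {(x, x) | x. x \<in> X} = card X"
proof -
  have "{(x, x) | x. x \<in> X} = (\<lambda>x. (x, x)) ` X" by auto
  then show ?thesis by (simp add: card_image inj_on_def)
qed

lemma fooling_set1_diagonalI:
  assumes "\<And>x. x \<in> X \<Longrightarrow> f x x = 1"
    and "\<And>x y. x \<in> X \<Longrightarrow> y \<in> X \<Longrightarrow> x \<noteq> y \<Longrightarrow> f x y = 0 \<or> f y x = 0"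
  shows "fooling_set1 X X f {(x, x) | x. x \<in> X}"
  using assms unfolding fooling_set1_def by auto

section \<open>The AND of k instances\<close>

lemma finite_tuples6: "finite (tuples6 k)"
  by (simp add: tuples6_def finite_PiE)

lemma card_tuples6: "card (tuples6 k) = 6 ^ k"
  by (simp add: tuples6_def card_PiE)

text \<open>Absolute value is multiplicative, so \<open>and_g\<close> inherits the zero pattern of
  the tensor power of \<open>A\<close>.\<close>

lemma and_g_eq_abs: "and_g k x y = \<bar>tensor_power k A x y\<bar>"
proof -
  have "(\<Prod>i\<in>I. \<bar>h i\<bar>) = \<bar>\<Prod>i\<in>I. h i\<bar>" for I :: "nat set" and h :: "nat \<Rightarrow> int"
    by (induction I rule: infinite_finite_induct) (simp_all add: abs_mult)
  then show ?thesis by (simp only: and_g_def tensor_power_def g_def)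
qed

lemma and_g_eq_1_iff:
  assumes "x \<in> tuples6 k" "y \<in> tuples6 k"
  shows "and_g k x y = 1 \<longleftrightarrow> and_g k x y \<noteq> 0"
proof -
  have "g (x i) (y i) \<in> {0, 1}" if "i \<in> {1..k}" for i
    using assms that by (intro g_binary) (auto simp: tuples6_def PiE_iff)
  then show ?thesis
    unfolding and_g_def by (metis (no_types, lifting) insertE singletonD prod.neutral
      finite_atLeastAtMost prod_zero_iff zero_neq_one)
qed

lemma and_g_diag:
  assumes "x \<in> tuples6 k"
  shows "and_g k x x = 1"
  unfolding and_g_def using assms
  by (intro prod.neutral ballI g_diag) (auto simp: tuples6_def PiE_iff)

text \<open>At a coordinate where the tuples differ, \<open>g\<close> is 0 in one of the two orders,
  and this factor annihilates the whole product.\<close>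

lemma and_g_off_diag:
  assumes "x \<in> tuples6 k" "y \<in> tuples6 k" "x \<noteq> y"
  shows "and_g k x y = 0 \<or> and_g k y x = 0"
proof -
  obtain i where i: "i \<in> {1..k}" "x i \<noteq> y i"
    using assms PiE_ext unfolding tuples6_def by blast
  then have "g (x i) (y i) = 0 \<or> g (y i) (x i) = 0"
    using assms by (intro g_off_diag) (auto simp: tuples6_def PiE_iff)
  with i show ?thesis by (auto simp: and_g_def intro: prod_zero)
qed

lemma of_int_tensor_power:
  "tensor_power k (\<lambda>i j. of_int (M i j)) x y = of_int (tensor_power k M x y)"
  by (simp add: tensor_power_def)

lemma of_int_A_factorization:
  assumes "i \<in> {1..6}" "j \<in> {1..6}"
  shows "(of_int (A i j) :: 'a::comm_ring_1)
    = (\<Sum>l\<in>{1, 2, 3}. of_int (A i l) * of_int (A_coeff l j))"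
  unfolding A_factorization[OF assms] of_int_sum of_int_mult ..

lemma of_int_A_dual:
  assumes "l \<in> {1, 2, 3}" "l' \<in> {1, 2, 3}"
  shows "(\<Sum>i\<in>{1..6}. of_int (A_dual l i) * of_int (A i l')) = (if l = l' then 1 else 0 :: 'a::comm_ring_1)"
  unfolding of_int_mult [symmetric] of_int_sum [symmetric] A_dual[OF assms] by simp

text \<open>The tensored factorization has inner dimension \<open>3 ^ k\<close>: Alice's vectors
  come from the basis columns of \<open>A\<close>, Bob's from \<open>A_coeff\<close>.\<close>

lemma NQ_and_g_le:
  assumes "3 ^ k \<le> (2::nat) ^ n" "n > 0"
  shows "NQ (tuples6 k) (tuples6 k) (and_g k) \<le> n + 1"
proof -
  let ?D = "{1..k} \<rightarrow>\<^sub>E {1, 2, 3::nat}"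
  let ?u = "\<lambda>x z. real_of_int (tensor_power k A x z)"
  let ?v = "\<lambda>y z. real_of_int (tensor_power k A_coeff z y)"
  have fact: "(\<Sum>z\<in>?D. ?u x z * ?v y z) = real_of_int (tensor_power k A x y)"
    if "x \<in> tuples6 k" "y \<in> tuples6 k" for x y
  proof -
    have "tensor_power k A x y = tensor_power k (\<lambda>i j. \<Sum>l\<in>{1, 2, 3}. A i l * A_coeff l j) x y"
      by (rule tensor_power_cong[OF A_factorization that[unfolded tuples6_def]])
    also have "\<dots> = (\<Sum>z\<in>?D. tensor_power k A x z * tensor_power k A_coeff z y)"
      by (rule tensor_power_matrix_mult[symmetric]) simp
    finally show ?thesis by simp
  qed
  show ?thesis
  proof (rule NQ_le)
    show "finite ?D" by (simp add: finite_PiE)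
    show "card ?D \<le> 2 ^ n" using assms(1) by (simp add: card_PiE numeral_3_eq_3)
    show fact': "and_g k x y = 1 \<longleftrightarrow> (\<Sum>z\<in>?D. ?u x z * ?v y z) \<noteq> 0"
      if "x \<in> tuples6 k" "y \<in> tuples6 k" for x y
      unfolding fact[OF that] and_g_eq_1_iff[OF that] by (simp add: and_g_eq_abs)
    \<comment> \<open>The diagonal entry at \<open>y\<close> is nonzero and is an inner product with
      \<open>?v y\<close>, so \<open>?v y\<close> cannot vanish.\<close>
    show "\<exists>z\<in>?D. ?v y z \<noteq> 0" if "y \<in> tuples6 k" for y
      using fact'[OF that that] and_g_diag[OF that]
      by (metis (no_types, lifting) mult_zero_right sum.neutral)
  qed (rule assms(2))
qed

text \<open>The bounds, 0.6125 and 0.61333..., enclose an open interval within distance 0.0005 of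
  0.613. They come from \<open>6 ^ 49 < 3 ^ 80\<close> and \<open>3 ^ 75 < 6 ^ 46\<close>, decided
  by evaluation.\<close>

lemma log_ratio_bounds: "49 / 80 < log 2 3 / log 2 (6::real)" "log 2 3 / log 2 (6::real) < 46 / 75"
proof -
  have pos: "log 2 (6::real) > 0" by simp
  have "log 2 ((6::real) ^ 49) < log 2 (3 ^ 80)"
    by (subst log_less_cancel_iff) simp_all
  then have "49 * log 2 (6::real) < 80 * log 2 3"
    by (simp only: log_nat_power zero_less_numeral of_nat_numeral)
  then show "49 / 80 < log 2 3 / log 2 (6::real)" using pos by (simp add: field_simps)
  have "log 2 ((3::real) ^ 75) < log 2 (6 ^ 46)"
    by (subst log_less_cancel_iff) simp_all
  then have "75 * log 2 3 < 46 * log 2 (6::real)"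
    by (simp only: log_nat_power zero_less_numeral of_nat_numeral)
  then show "log 2 3 / log 2 (6::real) < 46 / 75" using pos by (simp add: field_simps)
qed

theorem mainTheorem6:
  fixes k :: nat
  assumes "k \<ge> 1"
  shows "(\<forall>i\<in>{1..6}. \<forall>j\<in>{1..6}. g i j \<in> {0, 1})
    \<and> rank_on {1..6} {1..6} (\<lambda>i j. complex_of_int (A i j)) = 3
    \<and> fooling_set1 {1..6} {1..6} g {(i, i) | i. i \<in> {1..6}}
    \<and> card {(i, i) | i. i \<in> {1..6::nat}} = 6
    \<and> card (tuples6 k) = 6 ^ k
    \<and> fool1 (tuples6 k) (tuples6 k) (and_g k) = 6 ^ k
    \<and> nondet_matrix (tuples6 k) (tuples6 k) (and_g k) (tensor_power k (\<lambda>i j. complex_of_int (A i j)))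
    \<and> rank_on (tuples6 k) (tuples6 k) (tensor_power k (\<lambda>i j. complex_of_int (A i j))) = 3 ^ k
    \<and> real (NQ (tuples6 k) (tuples6 k) (and_g k))
        \<le> of_int \<lceil>log 2 3 / log 2 6 * log 2 (real (fool1 (tuples6 k) (tuples6 k) (and_g k)))\<rceil> + 1
    \<and> \<bar>log 2 3 / log 2 6 - 0.613\<bar> < (0.0005 :: real)"
proof (intro conjI ballI)
  show "g i j \<in> {0, 1}" if "i \<in> {1..6}" "j \<in> {1..6}" for i j
    using that by (rule g_binary)
  show "rank_on {1..6} {1..6} (\<lambda>i j. complex_of_int (A i j)) = 3"
    by (subst rank_on_eq_card[OF _ _ _ of_int_A_factorization of_int_A_dual]) auto
  show "fooling_set1 {1..6} {1..6} g {(i, i) | i. i \<in> {1..6}}"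
    using g_diag g_off_diag by (rule fooling_set1_diagonalI)
  show "card {(i, i) | i. i \<in> {1..6::nat}} = 6"
    by (simp only: card_diagonal) simp
  show "card (tuples6 k) = 6 ^ k" by (rule card_tuples6)
  have fool: "fool1 (tuples6 k) (tuples6 k) (and_g k) = 6 ^ k"
    using fool1_eq_card[OF fooling_set1_diagonalI[OF and_g_diag and_g_off_diag] finite_tuples6 card_diagonal]
    by (simp add: card_tuples6)
  then show "fool1 (tuples6 k) (tuples6 k) (and_g k) = 6 ^ k" .
  show "nondet_matrix (tuples6 k) (tuples6 k) (and_g k)
      (tensor_power k (\<lambda>i j. complex_of_int (A i j)))"
    by (simp add: nondet_matrix_def of_int_tensor_power and_g_eq_abs)
  show "rank_on (tuples6 k) (tuples6 k) (tensor_power k (\<lambda>i j. complex_of_int (A i j))) = 3 ^ k"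
    unfolding tuples6_def
    by (subst rank_on_tensor_power[OF _ _ _ of_int_A_factorization of_int_A_dual])
      (auto simp: numeral_3_eq_3)
  \<comment> \<open>The least number of qubits whose \<open>2 ^ n\<close> basis states accommodate
    dimension \<open>3 ^ k\<close>.\<close>
  define n where "n = nat \<lceil>log 2 (3 ^ k)\<rceil>"
  have "log 2 (6::real) > 0" by simp
  then have log_6: "log 2 (6::real) \<noteq> 0" by linarith
  \<comment> \<open>As \<open>k \<ge> 1\<close>, the logarithm is positive: hence
    \<open>n > 0\<close>, as the protocol requires, and \<open>nat\<close> does not truncate the
    ceiling.\<close>
  have log_pos: "log 2 (3 ^ k) > (0::real)" using assms by (simp add: log_nat_power)
  then have "n > 0" by (simp add: n_def)
  have "log 2 (3 ^ k) \<le> real n" unfolding n_def by linarith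
  then have "(3::real) ^ k \<le> 2 ^ n"
    by (simp add: log_le_iff powr_realpow)
  then have "(3::nat) ^ k \<le> 2 ^ n"
    by (metis of_nat_le_iff of_nat_numeral of_nat_power)
  then have "NQ (tuples6 k) (tuples6 k) (and_g k) \<le> n + 1"
    using \<open>n > 0\<close> by (rule NQ_and_g_le)
  \<comment> \<open>The fooling number is \<open>6 ^ k\<close>, so \<open>log 2 6\<close> cancels
    and the ceiling in the claim is exactly \<open>n\<close>.\<close>
  moreover have "log 2 3 / log 2 6 * log 2 (real (fool1 (tuples6 k) (tuples6 k) (and_g k))) = log 2 (3 ^ k)"
    using log_6 by (simp add: fool log_nat_power)
  moreover have "real_of_int \<lceil>log 2 (3 ^ k)\<rceil> = real n"
    using log_pos by (simp add: n_def)
  ultimately show "real (NQ (tuples6 k) (tuples6 k) (and_g k))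
      \<le> of_int \<lceil>log 2 3 / log 2 6 * log 2 (real (fool1 (tuples6 k) (tuples6 k) (and_g k)))\<rceil> + 1"
    by simp
  show "\<bar>log 2 3 / log 2 6 - 0.613\<bar> < (0.0005 :: real)"
  proof -
    have "\<bar>r - 0.613\<bar> < 0.0005" if "49 / 80 < r" "r < 46 / 75" for r :: real
      using that by (simp add: abs_if)
    then show ?thesis using log_ratio_bounds .
  qed
qed

end
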